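(* Let $k>17$. Consider any $k$-HST, and let $D$ be the maximal out-degree of a vertex in the tree defining the $k$-HST. Then for every Banach space $X$ with $\dim X\ge\log_2 D$, the $k$-HST admits a bilipschitz embedding into $X$ with distortion not exceeding $\displaystyle\frac{16k}{k-17}$.
   Context: For $k\ge 1$, a $k$-hierarchically well-separated tree ($k$-HST) is a metric space whose elements are the leaves of a (finite) rooted tree $T$ (the tree defining the $k$-HST). To each vertex $u\in T$ there is associated a label $\Delta(u)\ge 0$ such that $\Delta(u)=0$ if and only if $u$ is a leaf of $T$. It is required that if a vertex $u$ is a child of a vertex $v$ then $\Delta(u)\le\Delta(v)/k$. The distance between two distinct leaves $x,y$ is $\Delta(\operatorname{lca}(x,y))$, where $\operatorname{lca}(x,y)$ is the least common ancestor of $x$ and $y$ in $T$. The out-degree of a vertex is its number of children. The distortion of an injective map $f:X\to Y$ between metric spaces is $\sup_{x\ne y}\frac{d_Y(f(x),f(y))}{d_X(x,y)}\cdot\sup_{x\ne y}\frac{d_X(x,y)}{d_Y(f(x),f(y))}$. *)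

theory Defs
  imports "HOL-Analysis.Analysis"
begin

text \<open>
  A finite rooted tree on the vertex set \<open>V\<close> with root \<open>r\<close>; \<open>(v, u) \<in> E\<close> means that
  \<open>u\<close> is a child of \<open>v\<close>. The axioms exclude cycles, see \<open>acyclic_E\<close> below.
\<close>

locale rooted_tree =
  fixes V :: "'v set" and E :: "('v \<times> 'v) set" and r :: 'v
  assumes finite_V: "finite V"
    and root_in_V: "r \<in> V"
    and E_subset: "E \<subseteq> V \<times> V"
    and root_no_parent: "\<And>v. (v, r) \<notin> E"
    and unique_parent: "\<And>u. u \<in> V \<Longrightarrow> u \<noteq> r \<Longrightarrow> \<exists>!v. (v, u) \<in> E"
    and reachable: "\<And>u. u \<in> V \<Longrightarrow> (r, u) \<in> E\<^sup>*"

definition children :: "('v \<times> 'v) set \<Rightarrow> 'v \<Rightarrow> 'v set" where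
  "children E v = {u. (v, u) \<in> E}"

definition tree_leaves :: "'v set \<Rightarrow> ('v \<times> 'v) set \<Rightarrow> 'v set" where
  "tree_leaves V E = {v \<in> V. children E v = {}}"

definition out_deg :: "('v \<times> 'v) set \<Rightarrow> 'v \<Rightarrow> nat" where
  "out_deg E v = card (children E v)"

text \<open>
  For the one-vertex tree the value is \<open>0\<close>. The condition \<open>log 2 D \<le> dim X\<close> is then
  vacuous, both with \<open>log 2 0 = - \<infinity>\<close> and with the library's \<open>log 2 0 = 0\<close>.
\<close>

definition max_out_deg :: "'v set \<Rightarrow> ('v \<times> 'v) set \<Rightarrow> nat" where
  "max_out_deg V E = Max (out_deg E ` V)"

text \<open>\<open>(u, x) \<in> E\<^sup>*\<close> means that \<open>u\<close> is an ancestor of \<open>x\<close>, possibly \<open>x\<close> itself.\<close>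

definition is_lca :: "('v \<times> 'v) set \<Rightarrow> 'v \<Rightarrow> 'v \<Rightarrow> 'v \<Rightarrow> bool" where
  "is_lca E x y u \<longleftrightarrow> (u, x) \<in> E\<^sup>* \<and> (u, y) \<in> E\<^sup>* \<and>
     (\<forall>w. (w, x) \<in> E\<^sup>* \<and> (w, y) \<in> E\<^sup>* \<longrightarrow> (w, u) \<in> E\<^sup>*)"

definition lca :: "('v \<times> 'v) set \<Rightarrow> 'v \<Rightarrow> 'v \<Rightarrow> 'v" where
  "lca E x y = (THE u. is_lca E x y u)"

text \<open>
  The tree together with its labels. The metric space it defines has the carrier
  \<open>tree_leaves V E\<close> and the distance \<open>hst_dist E \<Delta>\<close>, see \<open>metric_space_hst\<close> below.
\<close>

locale k_HST = rooted_tree V E r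
  for V :: "'v set" and E :: "('v \<times> 'v) set" and r :: 'v +
  fixes k :: real and \<Delta> :: "'v \<Rightarrow> real"
  assumes k_ge_1: "k \<ge> 1"
    and label_nonneg: "\<And>u. u \<in> V \<Longrightarrow> \<Delta> u \<ge> 0"
    and label_eq_0_iff: "\<And>u. u \<in> V \<Longrightarrow> \<Delta> u = 0 \<longleftrightarrow> u \<in> tree_leaves V E"
    and label_child: "\<And>u v. (v, u) \<in> E \<Longrightarrow> \<Delta> u \<le> \<Delta> v / k"

definition hst_dist :: "('v \<times> 'v) set \<Rightarrow> ('v \<Rightarrow> real) \<Rightarrow> 'v \<Rightarrow> 'v \<Rightarrow> real" where
  "hst_dist E \<Delta> x y = (if x = y then 0 else \<Delta> (lca E x y))"

text \<open>
  Distortion is meant for injective maps only: a vanishing denominator would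
  give the value 0. On a space with at most one point both suprema are over the
  empty set, and the distortion is 0.
\<close>

definition distortion ::
  "'a set \<Rightarrow> ('a \<Rightarrow> 'a \<Rightarrow> real) \<Rightarrow> ('b \<Rightarrow> 'b \<Rightarrow> real) \<Rightarrow> ('a \<Rightarrow> 'b) \<Rightarrow> ennreal" where
  "distortion A dA dB f =
     (SUP (x, y) \<in> {(x, y). x \<in> A \<and> y \<in> A \<and> x \<noteq> y}. ennreal (dB (f x) (f y) / dA x y)) *
     (SUP (x, y) \<in> {(x, y). x \<in> A \<and> y \<in> A \<and> x \<noteq> y}. ennreal (dA x y / dB (f x) (f y)))"

definition bilipschitz_embedding ::
  "'a set \<Rightarrow> ('a \<Rightarrow> 'a \<Rightarrow> real) \<Rightarrow> ('b \<Rightarrow> 'b \<Rightarrow> real) \<Rightarrow> ('a \<Rightarrow> 'b) \<Rightarrow> bool" where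
  "bilipschitz_embedding A dA dB f \<longleftrightarrow> inj_on f A \<and>
     (\<exists>a>0. \<exists>b>0. \<forall>x\<in>A. \<forall>y\<in>A. a * dA x y \<le> dB (f x) (f y) \<and> dB (f x) (f y) \<le> b * dA x y)"

text \<open>
  The linear dimension of a real vector space, with value \<open>\<infinity>\<close> for
  infinite-dimensional spaces (where the library's \<^const>\<open>dim\<close> is \<open>0\<close>).
\<close>

definition linear_dim :: "'a::real_vector itself \<Rightarrow> ereal" where
  "linear_dim _ =
     (if \<exists>B::'a set. finite B \<and> span B = UNIV then ereal (real (dim (UNIV :: 'a set))) else \<infinity>)"

context rooted_tree
begin

lemma parent_unique: "(v, u) \<in> E \<Longrightarrow> (w, u) \<in> E \<Longrightarrow> v = w"
  using E_subset root_no_parent unique_parent by blast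

lemma acyclic_E: "acyclic E"
proof -
  have *: "(v, v) \<notin> E\<^sup>+" if "(r, v) \<in> E\<^sup>*" for v
    using that
  proof (induction rule: rtrancl_induct)
    case base
    then show ?case using root_no_parent by (meson tranclD2)
  next
    case (step u v)
    show ?case
    proof
      assume "(v, v) \<in> E\<^sup>+"
      then obtain t where t: "(v, t) \<in> E\<^sup>*" "(t, v) \<in> E" by (meson tranclD2)
      then have "t = u" using step.hyps parent_unique by blast
      then show False using t step.hyps step.IH by (meson rtrancl_into_trancl2)
    qed
  qed
  show ?thesis
    unfolding acyclic_def
  proof (intro allI notI)
    fix v assume v: "(v, v) \<in> E\<^sup>+"
    then have "v \<in> V" using E_subset by (meson mem_Sigma_iff subsetD tranclD)
    then show False using v * reachable by blast
  qed
qed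

lemma ancestor_antisym: "(u, v) \<in> E\<^sup>* \<Longrightarrow> (v, u) \<in> E\<^sup>* \<Longrightarrow> u = v"
  using acyclic_E acyclic_impl_antisym_rtrancl antisymD by metis

lemma ancestor_linear:
  assumes "(u, x) \<in> E\<^sup>*" "(v, x) \<in> E\<^sup>*"
  shows "(u, v) \<in> E\<^sup>* \<or> (v, u) \<in> E\<^sup>*"
proof -
  have "single_valued (E\<inverse>)" using parent_unique by (auto simp: single_valued_def)
  from single_valued_confluent[OF this, of x u v] assms show ?thesis
    by (auto simp: rtrancl_converse)
qed

lemma ancestor_in_V: "(u, v) \<in> E\<^sup>* \<Longrightarrow> v \<in> V \<Longrightarrow> u \<in> V"
  using E_subset by (metis converse_rtranclE mem_Sigma_iff subsetD)

lemma is_lca_unique: "is_lca E x y u \<Longrightarrow> is_lca E x y v \<Longrightarrow> u = v"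
  unfolding is_lca_def using ancestor_antisym by blast

lemma is_lca_lca:
  assumes "x \<in> V" "y \<in> V"
  shows "is_lca E x y (lca E x y)"
proof -
  define anc where "anc v = {u. (u, v) \<in> E\<^sup>*}" for v
  define C where "C = anc x \<inter> anc y"
  have anc_V: "anc v \<subseteq> V" if "v \<in> V" for v
    using that ancestor_in_V by (auto simp: anc_def)
  have fin: "finite (anc v)" if "v \<in> V" for v
    using anc_V[OF that] finite_V finite_subset by blast
  have C_V: "C \<subseteq> V" using anc_V assms by (auto simp: C_def)
  have C: "finite C" "C \<noteq> {}"
    using fin[OF assms(1)] reachable assms by (auto simp: C_def anc_def)
  obtain u where u: "u \<in> C" "\<And>w. w \<in> C \<Longrightarrow> card (anc w) \<le> card (anc u)"
  proof -
    have "Max ((\<lambda>w. card (anc w)) ` C) \<in> (\<lambda>w. card (anc w)) ` C" using C by (intro Max_in) auto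
    then obtain u where "u \<in> C" "card (anc u) = Max ((\<lambda>w. card (anc w)) ` C)" by auto
    then show thesis using C that by simp
  qed
  have "(w, u) \<in> E\<^sup>*" if w: "w \<in> C" for w
  proof (rule ccontr)
    assume no: "(w, u) \<notin> E\<^sup>*"
    with ancestor_linear[of u x w] u w have "(u, w) \<in> E\<^sup>*" by (auto simp: C_def anc_def)
    then have "anc u \<subset> anc w" using no by (auto simp: anc_def)
    then have "card (anc u) < card (anc w)" using fin w C_V by (meson psubset_card_mono subsetD)
    then show False using u(2)[OF w] by simp
  qed
  then have "is_lca E x y u" using u(1) by (auto simp: is_lca_def C_def anc_def)
  then show ?thesis unfolding lca_def using is_lca_unique by (metis theI)
qed

end

context k_HST
begin

lemma label_antimono:
  assumes "(u, v) \<in> E\<^sup>*"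
  shows "\<Delta> v \<le> \<Delta> u"
  using assms
proof (induction rule: rtrancl_induct)
  case (step v w)
  have "v \<in> V" using step.hyps E_subset by auto
  then have "\<Delta> v / k \<le> \<Delta> v / 1" using label_nonneg k_ge_1 by (intro divide_left_mono) auto
  then show ?case using label_child[OF step.hyps(2)] step.IH by simp
qed simp

lemma leaf_ancestor: "x \<in> tree_leaves V E \<Longrightarrow> (x, y) \<in> E\<^sup>* \<Longrightarrow> x = y"
  by (auto simp: tree_leaves_def children_def elim: converse_rtranclE)

text \<open>
  The locale \<^locale>\<open>Metric_space\<close> also asks for nonnegativity and symmetry outside of the
  carrier, hence the cut-off.
\<close>

lemma metric_space_hst:
  "Metric_space (tree_leaves V E)
     (\<lambda>x y. if x \<in> tree_leaves V E \<and> y \<in> tree_leaves V E then hst_dist E \<Delta> x y else 0)"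
proof -
  have leafV: "x \<in> V" if "x \<in> tree_leaves V E" for x
    using that by (simp add: tree_leaves_def)
  have lca: "lca E x y \<in> V" "is_lca E x y (lca E x y)"
    if "x \<in> tree_leaves V E" "y \<in> tree_leaves V E" for x y
  proof -
    show "is_lca E x y (lca E x y)" using that leafV is_lca_lca by blast
    then show "lca E x y \<in> V" using that leafV ancestor_in_V unfolding is_lca_def by blast
  qed
  have sym: "hst_dist E \<Delta> x y = hst_dist E \<Delta> y x" for x y
    by (simp add: hst_dist_def lca_def is_lca_def conj_commute conj_left_commute)
  have nonneg: "hst_dist E \<Delta> x y \<ge> 0"
    if "x \<in> tree_leaves V E" "y \<in> tree_leaves V E" for x y
    using lca(1)[OF that] label_nonneg by (simp add: hst_dist_def)
  have zero: "hst_dist E \<Delta> x y = 0 \<longleftrightarrow> x = y"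
    if xy: "x \<in> tree_leaves V E" "y \<in> tree_leaves V E" for x y
  proof
    assume 0: "hst_dist E \<Delta> x y = 0"
    show "x = y"
    proof (rule ccontr)
      assume "x \<noteq> y"
      with 0 have "lca E x y \<in> tree_leaves V E"
        using lca(1)[OF xy] label_eq_0_iff by (simp add: hst_dist_def)
      then have "lca E x y = x" "lca E x y = y"
        using lca(2)[OF xy] leaf_ancestor unfolding is_lca_def by blast+
      then show False using \<open>x \<noteq> y\<close> by simp
    qed
  qed (simp add: hst_dist_def)
  have tri: "hst_dist E \<Delta> x z \<le> hst_dist E \<Delta> x y + hst_dist E \<Delta> y z"
    if x: "x \<in> tree_leaves V E" and y: "y \<in> tree_leaves V E" and z: "z \<in> tree_leaves V E" for x y z
  proof (cases "x = y \<or> y = z \<or> x = z")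
    case True
    then show ?thesis
      using nonneg[OF x y] nonneg[OF y z] by (auto simp: hst_dist_def)
  next
    case False
    let ?u = "lca E x y" and ?v = "lca E y z" and ?w = "lca E x z"
    have "(?u, y) \<in> E\<^sup>*" "(?v, y) \<in> E\<^sup>*" "(?u, x) \<in> E\<^sup>*" "(?v, z) \<in> E\<^sup>*"
      using lca(2)[OF x y] lca(2)[OF y z] by (auto simp: is_lca_def)
    then have "(?u, ?w) \<in> E\<^sup>* \<or> (?v, ?w) \<in> E\<^sup>*"
      using ancestor_linear[of ?u y ?v] lca(2)[OF x z] unfolding is_lca_def
      by (meson rtrancl_trans)
    then have "\<Delta> ?w \<le> \<Delta> ?u \<or> \<Delta> ?w \<le> \<Delta> ?v" using label_antimono by blast
    moreover have "\<Delta> ?u \<ge> 0" "\<Delta> ?v \<ge> 0" using lca(1) x y z label_nonneg by auto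
    ultimately show ?thesis using False by (auto simp: hst_dist_def)
  qed
  show ?thesis
    by unfold_locales (use nonneg sym zero tri in auto)
qed

end

end

theory Submission
  imports Defs
begin

text \<open>
  The embedding sends a leaf \<open>x\<close> to the sum, over the edges \<open>(v, u)\<close> of the path from the root
  to \<open>x\<close>, of \<open>\<Delta> v\<close> times a vector \<open>q u\<close>, where the vectors attached to the children of one
  vertex have norm at most \<open>R\<close> and mutual distances at least \<open>1\<close>. For two leaves with
  lowest common ancestor \<open>u\<close> the paths agree above \<open>u\<close>. At \<open>u\<close> they leave by different children,
  which contributes a difference of norm between \<open>\<Delta> u\<close> and \<open>2 R \<Delta> u\<close>; below \<open>u\<close> the labels decay
  geometrically, so that everything there adds up to at most \<open>2 R \<Delta> u / (k - 1)\<close>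
  (\<open>path_sum_dist_bounds\<close>). The distortion is therefore at most \<open>2 R k / (k - 1 - 2 R)\<close>;
  for \<open>R = 8\<close> this is the claimed bound \<open>16 k / (k - 17)\<close>, and a smaller \<open>R\<close> gives a
  smaller value. The proof takes \<open>R = 3\<close>.

  It remains to find \<open>D\<close> points of a ball of radius \<open>3\<close> with mutual distances at least \<open>1\<close>, in
  a normed space that contains \<open>d\<close> independent vectors, \<open>D \<le> 2 ^ d\<close>
  (\<open>separated_points_in_ball\<close>). This is the usual comparison of volumes, but with lattice
  points in place of Lebesgue measure.
  Let \<open>L\<close> be the group generated by the independent vectors and \<open>N s\<close> the number of its points in
  the ball of radius \<open>s\<close> about the origin. Doubling a point of \<open>L\<close> and adding a subset sum of the
  generators is an injective operation, so \<open>2 ^ d * N s \<le> N (3 * s)\<close> as soon as \<open>s\<close> is at least the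
  norm of every subset sum. On the other hand, a maximal \<open>s\<close>-separated set \<open>S\<close> of points of \<open>L\<close> in
  the ball of radius \<open>3 * s\<close> satisfies \<open>N (3 * s) \<le> card S * N s\<close>, as the balls of radius \<open>s\<close>
  about its points cover all of these lattice points. Hence \<open>2 ^ d \<le> card S\<close>, and \<open>S\<close> is rescaled
  by \<open>1 / s\<close>. All of this needs \<open>N s\<close> to be finite, which holds because spans of finite sets are
  closed and so the coefficients of a vector are bounded by a multiple of its norm.
\<close>

section \<open>Finite-dimensional subspaces of a normed space\<close>

lemma norm_add_closed_subspace_ge:
  fixes Y :: "'a::real_normed_vector set"
  assumes "subspace Y" "closed Y" "x \<notin> Y"
  obtains \<delta> where "\<delta> > 0" "\<And>t y. y \<in> Y \<Longrightarrow> \<bar>t\<bar> * \<delta> \<le> norm (t *\<^sub>R x + y)"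
proof
  have "Y \<noteq> {}" using assms(1) subspace_0 by blast
  then show "infdist x Y > 0" using assms infdist_pos_not_in_closed by blast
  fix t :: real and y assume y: "y \<in> Y"
  show "\<bar>t\<bar> * infdist x Y \<le> norm (t *\<^sub>R x + y)"
  proof (cases "t = 0")
    case False
    have "- (1 / t) *\<^sub>R y \<in> Y" using assms(1) y subspace_scale by blast
    then have "infdist x Y \<le> dist x (- (1 / t) *\<^sub>R y)" by (rule infdist_le)
    then have "\<bar>t\<bar> * infdist x Y \<le> \<bar>t\<bar> * norm (x + (1 / t) *\<^sub>R y)"
      by (intro mult_left_mono) (auto simp: dist_norm)
    also have "\<dots> = norm (t *\<^sub>R (x + (1 / t) *\<^sub>R y))" by simp
    also have "\<dots> = norm (t *\<^sub>R x + y)" using False by (simp add: scaleR_add_right)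
    finally show ?thesis .
  qed simp
qed

text \<open>
  Adding one vector to a closed subspace preserves closedness: the preceding bound makes
  the coefficients of the new vector converge along any convergent sequence.
\<close>

lemma closed_span_finite:
  fixes B :: "'a::real_normed_vector set"
  assumes "finite B"
  shows "closed (span B)"
  using assms
proof (induction B)
  case empty
  then show ?case by simp
next
  case (insert x B)
  show ?case
  proof (cases "x \<in> span B")
    case True
    then show ?thesis using insert.IH span_redundant[OF True] by metis
  next
    case False
    obtain \<delta> where \<delta>: "\<delta> > 0" "\<And>t y. y \<in> span B \<Longrightarrow> \<bar>t\<bar> * \<delta> \<le> norm (t *\<^sub>R x + y)"
      using norm_add_closed_subspace_ge[OF subspace_span insert.IH False] by blast
    show ?thesis
      unfolding closed_sequential_limits
    proof (intro allI impI, elim conjE)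
      fix f z assume f: "\<forall>n. f n \<in> span (insert x B)" and lim: "f \<longlonglongrightarrow> z"
      from f have "\<forall>n. \<exists>t. f n - t *\<^sub>R x \<in> span B" by (simp add: span_breakdown_eq)
      then obtain t where t: "\<And>n. f n - t n *\<^sub>R x \<in> span B" by metis
      have diff: "\<bar>t m - t n\<bar> * \<delta> \<le> norm (f m - f n)" for m n
        using \<delta>(2)[OF span_diff[OF t[of m] t[of n]], of "t m - t n"]
        by (simp add: algebra_simps)
      have "Cauchy t"
      proof (rule metric_CauchyI)
        fix e :: real assume "e > 0"
        then obtain M where M: "\<And>m n. m \<ge> M \<Longrightarrow> n \<ge> M \<Longrightarrow> dist (f m) (f n) < e * \<delta>"
          using metric_CauchyD[OF LIMSEQ_imp_Cauchy[OF lim], of "e * \<delta>"] \<delta>(1) by auto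
        have "dist (t m) (t n) < e" if "m \<ge> M" "n \<ge> M" for m n
        proof -
          have "\<bar>t m - t n\<bar> * \<delta> < e * \<delta>"
            using diff[of m n] M[OF that] by (simp add: dist_norm)
          then show ?thesis using \<delta>(1) by (simp add: dist_real_def)
        qed
        then show "\<exists>M. \<forall>m\<ge>M. \<forall>n\<ge>M. dist (t m) (t n) < e" by blast
      qed
      then obtain l where "t \<longlonglongrightarrow> l" using Cauchy_convergent convergent_def by blast
      then have "(\<lambda>n. f n - t n *\<^sub>R x) \<longlonglongrightarrow> z - l *\<^sub>R x" using lim by (intro tendsto_intros)
      then have "z - l *\<^sub>R x \<in> span B" by (rule closed_sequentially[OF insert.IH t])
      then show "z \<in> span (insert x B)" by (auto simp: span_breakdown_eq)
    qed
  qed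
qed

text \<open>
  The coefficient of \<open>b\<close> is controlled because \<open>b\<close> has positive distance from the closed
  span of the other vectors.
\<close>

lemma independent_coefficients_bounded:
  fixes B :: "'a::real_normed_vector set"
  assumes "finite B" "independent B"
  obtains C where "\<And>a b. b \<in> B \<Longrightarrow> \<bar>a b\<bar> \<le> C * norm (\<Sum>b\<in>B. a b *\<^sub>R b)"
proof -
  have "\<exists>C. \<forall>a. \<bar>a b\<bar> \<le> C * norm (\<Sum>b\<in>B. a b *\<^sub>R b)" if b: "b \<in> B" for b
  proof -
    have "b \<notin> span (B - {b})" using assms(2) b by (auto simp: dependent_def)
    moreover have "closed (span (B - {b}))" using assms(1) by (intro closed_span_finite) simp
    ultimately obtain \<delta> where
      \<delta>: "\<delta> > 0" "\<And>t y. y \<in> span (B - {b}) \<Longrightarrow> \<bar>t\<bar> * \<delta> \<le> norm (t *\<^sub>R b + y)"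
      using norm_add_closed_subspace_ge[OF subspace_span] by blast
    have "\<bar>a b\<bar> \<le> (1 / \<delta>) * norm (\<Sum>b\<in>B. a b *\<^sub>R b)" for a
    proof -
      have "(\<Sum>c\<in>B - {b}. a c *\<^sub>R c) \<in> span (B - {b})"
        by (intro span_sum span_scale span_base)
      from \<delta>(2)[OF this, of "a b"] have "\<bar>a b\<bar> * \<delta> \<le> norm (\<Sum>b\<in>B. a b *\<^sub>R b)"
        using assms(1) b by (simp add: sum.remove)
      then show ?thesis using \<delta>(1) by (simp add: field_simps)
    qed
    then show ?thesis by blast
  qed
  then obtain C where C: "\<And>a b. b \<in> B \<Longrightarrow> \<bar>a b\<bar> \<le> C b * norm (\<Sum>b\<in>B. a b *\<^sub>R b)" by metis
  show thesis
  proof (rule that)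
    fix a b assume b: "b \<in> B"
    have "C b \<le> (\<Sum>b\<in>B. \<bar>C b\<bar>)"
      using member_le_sum[of b B "\<lambda>b. \<bar>C b\<bar>"] assms(1) b by auto
    then have "C b * norm (\<Sum>b\<in>B. a b *\<^sub>R b) \<le> (\<Sum>b\<in>B. \<bar>C b\<bar>) * norm (\<Sum>b\<in>B. a b *\<^sub>R b)"
      by (intro mult_right_mono) auto
    then show "\<bar>a b\<bar> \<le> (\<Sum>b\<in>B. \<bar>C b\<bar>) * norm (\<Sum>b\<in>B. a b *\<^sub>R b)" using C[OF b, of a] by linarith
  qed
qed

section \<open>Separated points by counting lattice points\<close>

definition int_span :: "'a::real_vector set \<Rightarrow> 'a set" where
  "int_span B = range (\<lambda>z :: 'a \<Rightarrow> int. \<Sum>b\<in>B. of_int (z b) *\<^sub>R b)"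

lemma int_span_diff: "v \<in> int_span B \<Longrightarrow> w \<in> int_span B \<Longrightarrow> v - w \<in> int_span B"
proof -
  assume "v \<in> int_span B" "w \<in> int_span B"
  then obtain y z :: "'a \<Rightarrow> int"
    where "v = (\<Sum>b\<in>B. of_int (y b) *\<^sub>R b)" "w = (\<Sum>b\<in>B. of_int (z b) *\<^sub>R b)"
    by (auto simp: int_span_def)
  then have "v - w = (\<Sum>b\<in>B. of_int (y b - z b) *\<^sub>R b)"
    by (simp add: sum_subtractf scaleR_diff_left)
  then show ?thesis
    unfolding int_span_def by (intro range_eqI[of _ _ "\<lambda>b. y b - z b"])
qed

lemma finite_int_span_cball:
  fixes B :: "'a::real_normed_vector set"
  assumes "finite B" "independent B"
  shows "finite (int_span B \<inter> cball 0 s)"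
proof -
  obtain C where C: "\<And>a b. b \<in> B \<Longrightarrow> \<bar>a b\<bar> \<le> C * norm (\<Sum>b\<in>B. a b *\<^sub>R b)"
    using independent_coefficients_bounded[OF assms] by blast
  define m where "m = \<lceil>\<bar>C\<bar> * s\<rceil>"
  let ?v = "\<lambda>z :: 'a \<Rightarrow> int. \<Sum>b\<in>B. of_int (z b) *\<^sub>R b"
  have "int_span B \<inter> cball 0 s \<subseteq> ?v ` (PiE B (\<lambda>_. {-m..m}))"
  proof
    fix v assume v: "v \<in> int_span B \<inter> cball 0 s"
    then obtain z where z: "v = ?v z" by (auto simp: int_span_def)
    have "z b \<in> {-m..m}" if "b \<in> B" for b
    proof -
      have "\<bar>real_of_int (z b)\<bar> \<le> C * norm v" using C[OF that, of "\<lambda>b. of_int (z b)"] z by simp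
      also have "\<dots> \<le> \<bar>C\<bar> * norm v" by (intro mult_right_mono) auto
      also have "\<dots> \<le> \<bar>C\<bar> * s" using v by (intro mult_left_mono) auto
      also have "\<dots> \<le> of_int m" unfolding m_def by (rule le_of_int_ceiling)
      finally show ?thesis by (simp add: abs_le_iff)
    qed
    then have "restrict z B \<in> PiE B (\<lambda>_. {-m..m})" by auto
    moreover have "v = ?v (restrict z B)" using z by simp
    ultimately show "v \<in> ?v ` (PiE B (\<lambda>_. {-m..m}))" by blast
  qed
  then show ?thesis using assms(1) by (meson finite_PiE finite_atLeastAtMost_int finite_imageI finite_subset)
qed

text \<open>
  The subset sum of the generators can be read off from \<open>2 v + \<Sum>T\<close>: it is given by
  the parities of the coefficients.
\<close>

lemma double_add_subset_sum_inj:
  fixes B :: "'a::real_vector set"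
  assumes "finite B" "independent B"
  shows "inj_on (\<lambda>(v, T). 2 *\<^sub>R v + \<Sum>T) (int_span B \<times> Pow B)"
    and "(\<lambda>(v, T). 2 *\<^sub>R v + \<Sum>T) ` (int_span B \<times> Pow B) \<subseteq> int_span B"
proof -
  let ?c = "\<lambda>(z :: 'a \<Rightarrow> int) T b. 2 * z b + (if b \<in> T then 1 else 0)"
  have eq: "2 *\<^sub>R (\<Sum>b\<in>B. of_int (z b) *\<^sub>R b) + \<Sum>T = (\<Sum>b\<in>B. of_int (?c z T b) *\<^sub>R b)"
    if "T \<subseteq> B" for z :: "'a \<Rightarrow> int" and T
  proof -
    have "\<Sum>T = (\<Sum>b\<in>B. if b \<in> T then b else 0)"
      using that assms(1) by (simp add: sum.If_cases inf_absorb2)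
    then show ?thesis
      by (auto simp: scaleR_sum_right sum.distrib[symmetric] scaleR_add_left intro!: sum.cong)
  qed
  show "(\<lambda>(v, T). 2 *\<^sub>R v + \<Sum>T) ` (int_span B \<times> Pow B) \<subseteq> int_span B"
  proof clarify
    fix v T assume "v \<in> int_span B" "T \<subseteq> B"
    then obtain z :: "'a \<Rightarrow> int" where "v = (\<Sum>b\<in>B. of_int (z b) *\<^sub>R b)" by (auto simp: int_span_def)
    with eq[OF \<open>T \<subseteq> B\<close>, of z] show "2 *\<^sub>R v + \<Sum>T \<in> int_span B"
      unfolding int_span_def by (intro range_eqI[of _ _ "?c z T"]) (simp only:)
  qed
  show "inj_on (\<lambda>(v, T). 2 *\<^sub>R v + \<Sum>T) (int_span B \<times> Pow B)"
  proof (rule inj_onI, clarify)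
    fix v T w U
    assume v: "v \<in> int_span B" and w: "w \<in> int_span B" and TU: "T \<subseteq> B" "U \<subseteq> B"
      and same: "2 *\<^sub>R v + \<Sum>T = 2 *\<^sub>R w + \<Sum>U"
    obtain y z :: "'a \<Rightarrow> int"
      where y: "v = (\<Sum>b\<in>B. of_int (y b) *\<^sub>R b)" and z: "w = (\<Sum>b\<in>B. of_int (z b) *\<^sub>R b)"
      using v w by (auto simp: int_span_def)
    have "(\<Sum>b\<in>B. (of_int (?c y T b) - of_int (?c z U b)) *\<^sub>R b) = 0"
      using same eq[OF TU(1), of y] eq[OF TU(2), of z] y z
      by (simp add: sum_subtractf scaleR_diff_left)
    from independentD[OF assms(2,1) order_refl this]
    have c: "?c y T b = ?c z U b" if "b \<in> B" for b
      using that by (metis eq_iff_diff_eq_0 of_int_eq_iff)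
    have "b \<in> T \<longleftrightarrow> b \<in> U" if "b \<in> B" for b
      using arg_cong[OF c[OF that], of even] by (simp split: if_splits)
    then have "T = U" using TU by blast
    then show "v = w \<and> T = U" using same by simp
  qed
qed

lemma maximal_separated_subset:
  fixes F :: "'a::metric_space set"
  assumes "finite F"
  obtains S where "S \<subseteq> F" "\<And>x y. x \<in> S \<Longrightarrow> y \<in> S \<Longrightarrow> x \<noteq> y \<Longrightarrow> s \<le> dist x y"
    "\<And>x. x \<in> F \<Longrightarrow> x \<in> S \<or> (\<exists>y\<in>S. dist x y < s)"
proof -
  define \<S> where "\<S> = {S. S \<subseteq> F \<and> (\<forall>x\<in>S. \<forall>y\<in>S. x \<noteq> y \<longrightarrow> s \<le> dist x y)}"
  have "finite \<S>" using assms by (simp add: \<S>_def)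
  moreover have "{} \<in> \<S>" by (simp add: \<S>_def)
  ultimately obtain S where S: "S \<in> \<S>" and max: "\<And>S'. S' \<in> \<S> \<Longrightarrow> S \<subseteq> S' \<Longrightarrow> S = S'"
    using finite_has_maximal[of \<S>] by blast
  have "x \<in> S \<or> (\<exists>y\<in>S. dist x y < s)" if x: "x \<in> F" for x
  proof (rule ccontr)
    assume no: "\<not> (x \<in> S \<or> (\<exists>y\<in>S. dist x y < s))"
    then have "insert x S \<in> \<S>" using S x by (auto simp: \<S>_def dist_commute not_less)
    with max no show False by blast
  qed
  then show thesis using S that by (auto simp: \<S>_def)
qed

lemma separated_points_in_ball:
  fixes B :: "'a::real_normed_vector set"
  assumes B: "finite B" "independent B"
  obtains S :: "'a set" where "finite S" "2 ^ card B \<le> card S" "S \<subseteq> cball 0 3"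
    "\<And>x y. x \<in> S \<Longrightarrow> y \<in> S \<Longrightarrow> x \<noteq> y \<Longrightarrow> 1 \<le> dist x y"
proof -
  \<comment> \<open>The summand \<open>1\<close> keeps \<open>s\<close> positive when there are no generators.\<close>
  define s where "s = (\<Sum>b\<in>B. norm b) + 1"
  have s: "s > 0" unfolding s_def by (simp add: add_nonneg_pos sum_nonneg)
  have subset_sum: "norm (\<Sum>T) \<le> s" if "T \<subseteq> B" for T
  proof -
    have "norm (\<Sum>T) \<le> (\<Sum>b\<in>T. norm b)" by (rule norm_sum)
    also have "\<dots> \<le> (\<Sum>b\<in>B. norm b)" using that B(1) by (intro sum_mono2) auto
    finally show ?thesis by (simp add: s_def)
  qed
  define L where "L t = int_span B \<inter> cball 0 t" for t
  have fin: "finite (L t)" for t unfolding L_def using finite_int_span_cball[OF B] .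
  have "0 \<in> int_span B" unfolding int_span_def by (rule range_eqI[of _ _ "\<lambda>_. 0"]) simp
  then have "0 \<in> L s" using s by (simp add: L_def)
  then have pos: "card (L s) > 0" using fin card_gt_0_iff by blast

  let ?d = "\<lambda>(v, T). 2 *\<^sub>R v + \<Sum>T :: 'a"
  have "?d ` (L s \<times> Pow B) \<subseteq> L (3 * s)"
  proof clarify
    fix v T assume v: "v \<in> L s" and T: "T \<subseteq> B"
    have "norm (2 *\<^sub>R v + \<Sum>T) \<le> norm (2 *\<^sub>R v) + norm (\<Sum>T)" by (rule norm_triangle_ineq)
    also have "\<dots> \<le> 2 * s + s" using v subset_sum[OF T] by (simp add: L_def)
    finally have "norm (2 *\<^sub>R v + \<Sum>T) \<le> 3 * s" by simp
    moreover have "2 *\<^sub>R v + \<Sum>T \<in> int_span B"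
      using double_add_subset_sum_inj(2)[OF B] v T by (auto simp: L_def)
    ultimately show "2 *\<^sub>R v + \<Sum>T \<in> L (3 * s)" by (simp add: L_def)
  qed
  moreover have "inj_on ?d (L s \<times> Pow B)"
    by (rule inj_on_subset[OF double_add_subset_sum_inj(1)[OF B]]) (auto simp: L_def)
  ultimately have "card (L s \<times> Pow B) \<le> card (L (3 * s))"
    using fin card_inj_on_le by blast
  then have lower: "card (L s) * 2 ^ card B \<le> card (L (3 * s))"
    using B(1) by (simp add: card_cartesian_product card_Pow)

  obtain S where S: "S \<subseteq> L (3 * s)"
    and sep: "\<And>x y. x \<in> S \<Longrightarrow> y \<in> S \<Longrightarrow> x \<noteq> y \<Longrightarrow> s \<le> dist x y"
    and cover: "\<And>x. x \<in> L (3 * s) \<Longrightarrow> x \<in> S \<or> (\<exists>y\<in>S. dist x y < s)"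
    using maximal_separated_subset[OF fin[of "3 * s"], where s = s] by blast
  have finS: "finite S" using S fin finite_subset by blast
  have "L (3 * s) \<subseteq> (\<lambda>(x, v). x + v) ` (S \<times> L s)"
  proof
    fix w assume w: "w \<in> L (3 * s)"
    then obtain x where x: "x \<in> S" "dist w x \<le> s" using cover s by fastforce
    have "w - x \<in> L s"
      using w x S int_span_diff[of w B x] by (auto simp: L_def dist_norm norm_minus_commute)
    then show "w \<in> (\<lambda>(x, v). x + v) ` (S \<times> L s)"
      using x(1) by (intro image_eqI[of _ _ "(x, w - x)"]) auto
  qed
  then have "card (L (3 * s)) \<le> card (S \<times> L s)"
    using finS fin by (intro surj_card_le) auto
  also have "\<dots> = card (L s) * card S" by (simp add: card_cartesian_product)
  finally have "card (L s) * 2 ^ card B \<le> card (L s) * card S" using lower by linarith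
  then have card: "2 ^ card B \<le> card S" using pos by simp

  show thesis
  proof (rule that)
    let ?S = "(\<lambda>x. (1 / s) *\<^sub>R x) ` S"
    show "finite ?S" using finS by simp
    have "inj_on (\<lambda>x. (1 / s) *\<^sub>R x) S" using s by (auto simp: inj_on_def)
    then show "2 ^ card B \<le> card ?S" using card by (simp add: card_image)
    show "?S \<subseteq> cball 0 3" using S s by (auto simp: L_def field_simps)
    show "1 \<le> dist x y" if x: "x \<in> ?S" and y: "y \<in> ?S" and neq: "x \<noteq> y" for x y
    proof -
      obtain x' y' where xy: "x' \<in> S" "y' \<in> S" "x = (1 / s) *\<^sub>R x'" "y = (1 / s) *\<^sub>R y'"
        using x y by blast
      with neq have "s \<le> dist x' y'" by (intro sep) auto
      moreover have "dist x y = dist x' y' / s"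
        using s by (simp add: xy dist_norm scaleR_diff_right[symmetric])
      ultimately show ?thesis using s by simp
    qed
  qed
qed

lemma independent_subset_of_linear_dim:
  assumes "ereal (log 2 (real D)) \<le> linear_dim TYPE('a::real_vector)"
  obtains B :: "'a::real_vector set" where "finite B" "independent B" "D \<le> 2 ^ card B"
proof -
  obtain A :: "'a set" where A: "independent A" "UNIV \<subseteq> span A" "card A = dim (UNIV :: 'a set)"
    by (rule basis_exists[of "UNIV :: 'a set"])
  show thesis
  proof (cases "finite A")
    case True
    then have "linear_dim TYPE('a) = ereal (real (card A))"
      using A by (auto simp: linear_dim_def)
    then have "log 2 (real D) \<le> real (card A)" using assms by simp
    then have "D \<le> 2 ^ card A"
    proof (cases "D = 0")
      case False
      have "real D \<le> 2 powr real (card A)"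
        using \<open>log 2 (real D) \<le> real (card A)\<close> False by (simp add: log_le_iff)
      then show ?thesis by (simp add: powr_realpow)
    qed simp
    then show thesis using that A(1) True by blast
  next
    case False
    then obtain B where B: "finite B" "card B = D" "B \<subseteq> A"
      using infinite_arbitrarily_large by blast
    moreover have "D \<le> 2 ^ card B" using B(2) less_exp[of D] by simp
    ultimately show thesis using that A(1) independent_mono by blast
  qed
qed

section \<open>Distortion\<close>

lemma bilipschitz_embedding_distortion_le:
  assumes "a > 0" "b > 0"
    and pos: "\<And>x y. x \<in> A \<Longrightarrow> y \<in> A \<Longrightarrow> x \<noteq> y \<Longrightarrow> dA x y > 0"
    and refl: "\<And>x. x \<in> A \<Longrightarrow> dA x x = 0"
    and lower: "\<And>x y. x \<in> A \<Longrightarrow> y \<in> A \<Longrightarrow> x \<noteq> y \<Longrightarrow> a * dA x y \<le> dist (f x) (f y)"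
    and upper: "\<And>x y. x \<in> A \<Longrightarrow> y \<in> A \<Longrightarrow> x \<noteq> y \<Longrightarrow> dist (f x) (f y) \<le> b * dA x y"
  shows "bilipschitz_embedding A dA dist f \<and> distortion A dA dist f \<le> ennreal (b / a)"
proof
  have dist_pos: "dist (f x) (f y) > 0" if "x \<in> A" "y \<in> A" "x \<noteq> y" for x y
    using lower[OF that] pos[OF that] assms(1) by (meson less_le_trans mult_pos_pos)
  then have "inj_on f A" by (fastforce simp: inj_on_def)
  moreover have "a * dA x y \<le> dist (f x) (f y) \<and> dist (f x) (f y) \<le> b * dA x y"
    if "x \<in> A" "y \<in> A" for x y
    using lower upper refl that by (cases "x = y") auto
  ultimately show "bilipschitz_embedding A dA dist f"
    unfolding bilipschitz_embedding_def using assms(1,2) by blast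
  have 1: "dist (f x) (f y) / dA x y \<le> b" "dA x y / dist (f x) (f y) \<le> 1 / a"
    if "x \<in> A" "y \<in> A" "x \<noteq> y" for x y
    using upper[OF that] lower[OF that] pos[OF that] dist_pos[OF that] assms(1)
    by (auto simp: field_simps)
  have "distortion A dA dist f \<le> ennreal b * ennreal (1 / a)"
    unfolding distortion_def by (intro mult_mono SUP_least) (auto intro!: ennreal_leI 1)
  also have "\<dots> = ennreal (b / a)" using assms(1,2) by (simp add: ennreal_mult[symmetric])
  finally show "distortion A dA dist f \<le> ennreal (b / a)" .
qed

section \<open>Summing vectors along the paths of a tree\<close>

definition edges_above :: "('v \<times> 'v) set \<Rightarrow> 'v \<Rightarrow> ('v \<times> 'v) set" where
  "edges_above E x = {(v, u). (v, u) \<in> E \<and> (u, x) \<in> E\<^sup>*}"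

definition path_sum ::
  "('v \<times> 'v) set \<Rightarrow> ('v \<Rightarrow> real) \<Rightarrow> ('v \<Rightarrow> 'b::real_vector) \<Rightarrow> 'v \<Rightarrow> 'b" where
  "path_sum E \<Delta> q x = (\<Sum>(v, u)\<in>edges_above E x. \<Delta> v *\<^sub>R q u)"

context rooted_tree
begin

lemma no_path_to_parent: "(v, u) \<in> E \<Longrightarrow> (u, v) \<notin> E\<^sup>*"
  using acyclic_E by (meson acyclic_def rtrancl_into_trancl1)

lemma path_sum_child:
  assumes "(v, u) \<in> E"
  shows "path_sum E \<Delta> q u = path_sum E \<Delta> q v + \<Delta> v *\<^sub>R q u"
proof -
  have "finite E" using E_subset finite_V finite_subset by blast
  then have "finite (edges_above E v)"
    by (rule rev_finite_subset) (auto simp: edges_above_def)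
  moreover have "(v, u) \<notin> edges_above E v"
    using no_path_to_parent[OF assms] by (simp add: edges_above_def)
  moreover have "edges_above E u = insert (v, u) (edges_above E v)"
  proof (intro equalityI subsetI)
    fix e assume "e \<in> edges_above E u"
    then obtain w t where e: "e = (w, t)" "(w, t) \<in> E" "(t, u) \<in> E\<^sup>*" by (auto simp: edges_above_def)
    show "e \<in> insert (v, u) (edges_above E v)"
    proof (cases "t = u")
      case True
      then show ?thesis using e assms parent_unique by blast
    next
      case False
      then obtain p where "(t, p) \<in> E\<^sup>*" "(p, u) \<in> E" using e(3) by (metis rtranclE)
      then show ?thesis using e assms parent_unique by (auto simp: edges_above_def)
    qed
  next
    fix e assume "e \<in> insert (v, u) (edges_above E v)"
    then show "e \<in> edges_above E u" using assms by (auto simp: edges_above_def intro: rtrancl_into_rtrancl)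
  qed
  ultimately show ?thesis by (simp add: path_sum_def add.commute)
qed

text \<open>
  Each vertex other than the root is the child of exactly one vertex, so separate
  injections of the families of siblings into \<open>S\<close> combine into one map.
\<close>

lemma sibling_injective_map:
  assumes "finite S" "max_out_deg V E \<le> card S"
  obtains q where "\<And>v u. (v, u) \<in> E \<Longrightarrow> q u \<in> S"
    "\<And>v u u'. (v, u) \<in> E \<Longrightarrow> (v, u') \<in> E \<Longrightarrow> u \<noteq> u' \<Longrightarrow> q u \<noteq> q u'"
proof -
  have "\<exists>g. g ` children E v \<subseteq> S \<and> inj_on g (children E v)" if v: "v \<in> V" for v
  proof (rule card_le_inj)
    show "finite (children E v)"
      using E_subset by (intro finite_subset[OF _ finite_V]) (auto simp: children_def)
    have "card (children E v) \<le> max_out_deg V E"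
      unfolding max_out_deg_def using finite_V v by (intro Max_ge) (auto simp: out_deg_def)
    then show "card (children E v) \<le> card S" using assms(2) by simp
  qed (rule assms(1))
  then obtain g where g: "\<And>v. v \<in> V \<Longrightarrow> g v ` children E v \<subseteq> S"
    "\<And>v. v \<in> V \<Longrightarrow> inj_on (g v) (children E v)"
    by metis
  define q where "q u = g (THE v. (v, u) \<in> E) u" for u
  have q: "q u = g v u" if "(v, u) \<in> E" for v u
    unfolding q_def using that parent_unique by (metis the_equality)
  have V: "v \<in> V" if "(v, u) \<in> E" for v u using that E_subset by blast
  show thesis
  proof (rule that)
    show "q u \<in> S" if "(v, u) \<in> E" for v u
      using g(1)[OF V[OF that]] q[OF that] that by (auto simp: children_def)
    show "q u \<noteq> q u'" if "(v, u) \<in> E" "(v, u') \<in> E" "u \<noteq> u'" for v u u'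
      using inj_onD[OF g(2)[OF V[OF that(1)]], of u u'] q[OF that(1)] q[OF that(2)] that
      by (auto simp: children_def)
  qed
qed

lemma lca_children:
  assumes xy: "x \<in> tree_leaves V E" "y \<in> tree_leaves V E" "x \<noteq> y"
  obtains c c' where "(lca E x y, c) \<in> E" "(c, x) \<in> E\<^sup>*"
    "(lca E x y, c') \<in> E" "(c', y) \<in> E\<^sup>*" "c \<noteq> c'"
proof -
  let ?u = "lca E x y"
  have lca: "is_lca E x y ?u" using xy is_lca_lca by (simp add: tree_leaves_def)
  then have u: "(?u, x) \<in> E\<^sup>*" "(?u, y) \<in> E\<^sup>*" by (auto simp: is_lca_def)
  have leaf: "z = w" if "z \<in> tree_leaves V E" "(z, w) \<in> E\<^sup>*" for z w
    using that by (auto simp: tree_leaves_def children_def elim: converse_rtranclE)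
  have "?u \<noteq> x" "?u \<noteq> y" using leaf[of x y] leaf[of y x] u xy by auto
  then obtain c c' where c: "(?u, c) \<in> E" "(c, x) \<in> E\<^sup>*" "(?u, c') \<in> E" "(c', y) \<in> E\<^sup>*"
    using u by (metis converse_rtranclE)
  have "c \<noteq> c'"
  proof
    assume "c = c'"
    then have "(c, ?u) \<in> E\<^sup>*" using lca c by (auto simp: is_lca_def)
    then show False using no_path_to_parent c(1) by blast
  qed
  then show thesis using that c by blast
qed

end

context k_HST
begin

text \<open>
  The labels on a path that starts at \<open>u\<close> are dominated by a geometric series with first term
  \<open>\<Delta> u\<close> and ratio \<open>1 / k\<close>.
\<close>

lemma path_sum_tail:
  fixes q :: "'v \<Rightarrow> 'b::real_normed_vector"
  assumes k: "k > 1" and R: "R \<ge> 0"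
    and q: "\<And>v u. (v, u) \<in> E \<Longrightarrow> norm (q u) \<le> R"
    and ux: "(u, x) \<in> E\<^sup>*" and x: "x \<in> V"
  shows "norm (path_sum E \<Delta> q x - path_sum E \<Delta> q u) \<le> R * \<Delta> u * k / (k - 1)"
  using ux
proof (induction rule: converse_rtrancl_induct)
  case base
  then show ?case using label_nonneg[OF x] k R by simp
next
  case (step u c)
  have u: "\<Delta> u \<ge> 0" using step.hyps(1) E_subset label_nonneg by blast
  have "path_sum E \<Delta> q x - path_sum E \<Delta> q u
      = (path_sum E \<Delta> q x - path_sum E \<Delta> q c) + \<Delta> u *\<^sub>R q c"
    using path_sum_child[OF step.hyps(1), of \<Delta> q] by simp
  then have "norm (path_sum E \<Delta> q x - path_sum E \<Delta> q u)
      \<le> norm (path_sum E \<Delta> q x - path_sum E \<Delta> q c) + norm (\<Delta> u *\<^sub>R q c)"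
    using norm_triangle_ineq by metis
  also have "\<dots> \<le> R * \<Delta> c * k / (k - 1) + \<Delta> u * R"
    using step.IH q[OF step.hyps(1)] u by (auto intro!: add_mono mult_left_mono)
  also have "\<dots> \<le> R * (\<Delta> u / k) * k / (k - 1) + \<Delta> u * R"
    using label_child[OF step.hyps(1)] k R
    by (intro add_right_mono divide_right_mono mult_right_mono mult_left_mono) auto
  also have "\<dots> = R * \<Delta> u * k / (k - 1)" using k by (simp add: field_simps)
  finally show ?case .
qed

text \<open>
  In the upper bound the first step below the lowest common ancestor is counted with the
  tails; in the lower bound it is the main term, and only the tails below the
  children are discarded.
\<close>

lemma path_sum_dist_bounds:
  fixes q :: "'v \<Rightarrow> 'b::real_normed_vector"
  assumes k: "k > 1" and R: "R \<ge> 0"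
    and q: "\<And>v u. (v, u) \<in> E \<Longrightarrow> norm (q u) \<le> R"
    and sep: "\<And>v u u'. (v, u) \<in> E \<Longrightarrow> (v, u') \<in> E \<Longrightarrow> u \<noteq> u' \<Longrightarrow> 1 \<le> dist (q u) (q u')"
    and xy: "x \<in> tree_leaves V E" "y \<in> tree_leaves V E" "x \<noteq> y"
  shows "(k - 1 - 2 * R) / (k - 1) * hst_dist E \<Delta> x y
           \<le> dist (path_sum E \<Delta> q x) (path_sum E \<Delta> q y)"
    and "dist (path_sum E \<Delta> q x) (path_sum E \<Delta> q y)
           \<le> 2 * R * k / (k - 1) * hst_dist E \<Delta> x y"
proof -
  let ?f = "path_sum E \<Delta> q" and ?u = "lca E x y"
  obtain c c' where c: "(?u, c) \<in> E" "(c, x) \<in> E\<^sup>*" "(?u, c') \<in> E" "(c', y) \<in> E\<^sup>*" "c \<noteq> c'"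
    using lca_children[OF xy] by blast
  have V: "x \<in> V" "y \<in> V" using xy by (auto simp: tree_leaves_def)
  have u: "\<Delta> ?u \<ge> 0" using c(1) E_subset label_nonneg by blast
  have d: "hst_dist E \<Delta> x y = \<Delta> ?u" using xy(3) by (simp add: hst_dist_def)
  note tail = path_sum_tail[OF k R q]

  have "(?u, x) \<in> E\<^sup>*" "(?u, y) \<in> E\<^sup>*" using c by (auto intro: converse_rtrancl_into_rtrancl)
  then have up: "norm (?f x - ?f ?u) \<le> R * \<Delta> ?u * k / (k - 1)"
    "norm (?f y - ?f ?u) \<le> R * \<Delta> ?u * k / (k - 1)"
    using tail V by auto
  have "dist (?f x) (?f y) \<le> norm (?f x - ?f ?u) + norm (?f y - ?f ?u)"
    using dist_triangle2[of "?f x" "?f y" "?f ?u"] by (simp add: dist_norm)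
  also have "\<dots> \<le> R * \<Delta> ?u * k / (k - 1) + R * \<Delta> ?u * k / (k - 1)" by (intro add_mono up)
  also have "\<dots> = 2 * R * k / (k - 1) * \<Delta> ?u" by simp
  finally show "dist (?f x) (?f y) \<le> 2 * R * k / (k - 1) * hst_dist E \<Delta> x y" by (simp add: d)

  have low: "norm (?f z - ?f b) \<le> R * \<Delta> ?u / (k - 1)" if "(?u, b) \<in> E" "(b, z) \<in> E\<^sup>*" "z \<in> V" for b z
  proof -
    have "norm (?f z - ?f b) \<le> R * \<Delta> b * k / (k - 1)" using tail that by auto
    also have "\<dots> \<le> R * (\<Delta> ?u / k) * k / (k - 1)"
      using label_child[OF that(1)] k R
      by (intro divide_right_mono mult_right_mono mult_left_mono) auto
    finally show ?thesis using k by simp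
  qed
  have "\<Delta> ?u * 1 \<le> \<Delta> ?u * dist (q c) (q c')" using sep c u by (intro mult_left_mono) auto
  also have "\<dots> = dist (?f c) (?f c')"
    using u path_sum_child[OF c(1), of \<Delta> q] path_sum_child[OF c(3), of \<Delta> q]
    by (simp add: dist_norm scaleR_diff_right[symmetric])
  also have "\<dots> \<le> dist (?f x) (?f y) + norm (?f x - ?f c) + norm (?f y - ?f c')"
    using dist_triangle[of "?f c" "?f c'" "?f x"] dist_triangle[of "?f x" "?f c'" "?f y"]
    by (simp add: dist_norm norm_minus_commute)
  also have "\<dots> \<le> dist (?f x) (?f y) + R * \<Delta> ?u / (k - 1) + R * \<Delta> ?u / (k - 1)"
    using low c V by (intro add_mono order_refl) auto
  finally have "\<Delta> ?u - 2 * (R * \<Delta> ?u / (k - 1)) \<le> dist (?f x) (?f y)" by simp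
  moreover have "\<Delta> ?u - 2 * (R * \<Delta> ?u / (k - 1)) = (k - 1 - 2 * R) / (k - 1) * \<Delta> ?u"
    using k by (simp add: field_simps)
  ultimately show "(k - 1 - 2 * R) / (k - 1) * hst_dist E \<Delta> x y \<le> dist (?f x) (?f y)"
    by (simp add: d)
qed

lemma hst_dist_pos:
  assumes "x \<in> tree_leaves V E" "y \<in> tree_leaves V E" "x \<noteq> y"
  shows "hst_dist E \<Delta> x y > 0"
  using Metric_space.mdist_pos_less[OF metric_space_hst, of x y] assms by simp

end

theorem proposition2p15:
  fixes k :: real
    and V :: "'v set" and E :: "('v \<times> 'v) set" and r :: 'v and \<Delta> :: "'v \<Rightarrow> real"
  assumes "k > 17"
    and "k_HST V E r k \<Delta>"
    and "linear_dim TYPE('b::banach) \<ge> ereal (log 2 (real (max_out_deg V E)))"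
  shows "\<exists>f :: 'v \<Rightarrow> 'b.
      bilipschitz_embedding (tree_leaves V E) (hst_dist E \<Delta>) dist f \<and>
      distortion (tree_leaves V E) (hst_dist E \<Delta>) dist f \<le> ennreal (16 * k / (k - 17))"
proof -
  interpret k_HST V E r k \<Delta> by (rule assms(2))
  obtain B :: "'b set" where B: "finite B" "independent B" "max_out_deg V E \<le> 2 ^ card B"
    using independent_subset_of_linear_dim[OF assms(3)] by blast
  obtain S :: "'b set" where S: "finite S" "2 ^ card B \<le> card S" "S \<subseteq> cball 0 3"
    and sep: "\<And>x y. x \<in> S \<Longrightarrow> y \<in> S \<Longrightarrow> x \<noteq> y \<Longrightarrow> 1 \<le> dist x y"
    using separated_points_in_ball[OF B(1,2)] by blast
  have "max_out_deg V E \<le> card S" using B(3) S(2) by simp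
  then obtain q where q: "\<And>v u. (v, u) \<in> E \<Longrightarrow> q u \<in> S"
    "\<And>v u u'. (v, u) \<in> E \<Longrightarrow> (v, u') \<in> E \<Longrightarrow> u \<noteq> u' \<Longrightarrow> q u \<noteq> q u'"
    using sibling_injective_map[OF S(1)] by blast
  have norm_q: "norm (q u) \<le> 3" if "(v, u) \<in> E" for v u using q(1)[OF that] S(3) by auto
  have sep_q: "1 \<le> dist (q u) (q u')" if "(v, u) \<in> E" "(v, u') \<in> E" "u \<noteq> u'" for v u u'
    using that q sep by blast
  have k: "k > 1" using assms(1) by simp
  note bounds = path_sum_dist_bounds[of 3 q, OF k _ norm_q sep_q, simplified]
  let ?f = "path_sum E \<Delta> q"
  have "bilipschitz_embedding (tree_leaves V E) (hst_dist E \<Delta>) dist ?f \<and>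
      distortion (tree_leaves V E) (hst_dist E \<Delta>) dist ?f
        \<le> ennreal (6 * k / (k - 1) / ((k - 7) / (k - 1)))"
    using assms(1) bounds hst_dist_pos
    by (intro bilipschitz_embedding_distortion_le) (auto simp: hst_dist_def)
  moreover have "6 * k / (k - 1) / ((k - 7) / (k - 1)) \<le> 16 * k / (k - 17)"
  proof -
    have "6 * k / (k - 1) / ((k - 7) / (k - 1)) = 6 * k / (k - 7)" using assms(1) by simp
    also have "\<dots> \<le> 16 * k / (k - 17)" using assms(1) by (intro frac_le) auto
    finally show ?thesis .
  qed
  ultimately show ?thesis by (meson ennreal_leI order_trans)
qed

end
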